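(* Let $(\psi_k)_{k\in K}$ be a Riesz basis for $\mathcal{H}_1$ with bounds $A,B$ and let $(\phi_k)_{k\in K}$ be a Riesz basis for $\mathcal{H}_2$ with bounds $A',B'$. Then $$\sqrt{AA'}\,\|m\|_\infty\le\|\mathbf{M}_{m,(\phi_k),(\psi_k)}\|_{Op}\le\sqrt{BB'}\,\|m\|_\infty .$$ In particular, $\mathbf{M}_{m,(\phi_k),(\psi_k)}$ is bounded if and only if $m$ is bounded.
   Context: $\mathcal{H}_1,\mathcal{H}_2$ are separable Hilbert spaces, with inner products linear in the first argument, and $K$ is the common index set. A complete sequence $(\psi_k)_{k\in K}$ in a Hilbert space $\mathcal{H}$ is a Riesz basis with bounds $A,B>0$ if $A\|c\|_2^2\le\|\sum_k c_k\psi_k\|^2\le B\|c\|_2^2$ for all $c\in l^2(K)$. The multiplier with symbol $m=(m_k)_{k\in K}$ is the operator $\mathbf{M}_{m,(\phi_k),(\psi_k)}:\mathcal{H}_1\to\mathcal{H}_2$ given by $\mathbf{M}_{m,(\phi_k),(\psi_k)}f=\sum_k m_k\langle f,\psi_k\rangle\phi_k$; multipliers are defined for symbols $m\in l^\infty(K)$, and the "if and only if" refers to the operator given by this same formula. $\|O\|_{Op}=\sup_{\|x\|\le1}\|Ox\|$ is the operator norm and $\|m\|_\infty=\sup_k|m_k|$. *)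

theory Defs
  imports "HOL-Analysis.Analysis"
begin

class complex_vector = real_vector +
  fixes scaleC :: "complex \<Rightarrow> 'a \<Rightarrow> 'a" (infixr "*\<^sub>C" 75)
  assumes scaleC_add_right: "a *\<^sub>C (x + y) = a *\<^sub>C x + a *\<^sub>C y"
    and scaleC_add_left: "(a + b) *\<^sub>C x = a *\<^sub>C x + b *\<^sub>C x"
    and scaleC_scaleC: "a *\<^sub>C (b *\<^sub>C x) = (a * b) *\<^sub>C x"
    and scaleC_one: "1 *\<^sub>C x = x"
    and scaleR_scaleC: "r *\<^sub>R x = complex_of_real r *\<^sub>C x"

global_interpretation complex_vector: vector_space
  "scaleC :: complex \<Rightarrow> 'a \<Rightarrow> 'a::complex_vector"
  defines cspan = "complex_vector.span"
  by unfold_locales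
    (simp_all add: scaleC_add_right scaleC_add_left scaleC_scaleC scaleC_one)

text \<open>Complex Hilbert spaces. Definiteness of the inner product follows from
  \<open>cinner_self\<close> and the norm axioms; completeness is part of \<^class>\<open>banach\<close>.\<close>

class complex_hilbert = complex_vector + banach +
  fixes cinner :: "'a \<Rightarrow> 'a \<Rightarrow> complex"
  assumes cinner_add_left: "cinner (x + y) z = cinner x z + cinner y z"
    and cinner_scaleC_left: "cinner (a *\<^sub>C x) y = a * cinner x y"
    and cinner_commute: "cinner x y = cnj (cinner y x)"
    and cinner_self: "cinner x x = complex_of_real ((norm x)\<^sup>2)"

definition l2 :: "'k set \<Rightarrow> ('k \<Rightarrow> complex) set" where
  "l2 K = {c. (\<lambda>k. (cmod (c k))\<^sup>2) summable_on K}"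

definition l2_norm :: "'k set \<Rightarrow> ('k \<Rightarrow> complex) \<Rightarrow> real" where
  "l2_norm K c = sqrt (\<Sum>\<^sub>\<infinity>k\<in>K. (cmod (c k))\<^sup>2)"

definition linf :: "'k set \<Rightarrow> ('k \<Rightarrow> complex) set" where
  "linf K = {m. bounded (m ` K)}"

text \<open>Suprema of norms are taken in \<^typ>\<open>ennreal\<close>, so that they are infinite in the
  unbounded case and zero (instead of unspecified) for an empty index set.\<close>

definition linf_norm :: "'k set \<Rightarrow> ('k \<Rightarrow> complex) \<Rightarrow> ennreal" where
  "linf_norm K m = (SUP k\<in>K. ennreal (cmod (m k)))"

text \<open>Sums over \<open>K\<close> carry no order and are therefore unconditional; their existence for
  every \<open>c\<close> in \<open>l2 K\<close> is part of the Riesz condition, as \<^const>\<open>infsum\<close> is zero on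
  divergent families.\<close>

definition riesz_basis ::
  "'k set \<Rightarrow> ('k \<Rightarrow> 'a::complex_hilbert) \<Rightarrow> real \<Rightarrow> real \<Rightarrow> bool" where
  "riesz_basis K \<psi> A B \<longleftrightarrow>
     0 < A \<and> 0 < B \<and> closure (cspan (\<psi> ` K)) = UNIV \<and>
     (\<forall>c\<in>l2 K. (\<lambda>k. c k *\<^sub>C \<psi> k) summable_on K \<and>
        A * (l2_norm K c)\<^sup>2 \<le> (norm (\<Sum>\<^sub>\<infinity>k\<in>K. c k *\<^sub>C \<psi> k))\<^sup>2 \<and>
        (norm (\<Sum>\<^sub>\<infinity>k\<in>K. c k *\<^sub>C \<psi> k))\<^sup>2 \<le> B * (l2_norm K c)\<^sup>2)"

text \<open>For an unbounded symbol the series of the multiplier need not converge everywhere, so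
  a multiplier is treated as an operator on its domain of convergence;
  \<open>multiplier\<close> is meaningful only on \<open>multiplier_dom\<close>.\<close>

definition multiplier_dom ::
  "'k set \<Rightarrow> ('k \<Rightarrow> complex) \<Rightarrow> ('k \<Rightarrow> 'b::complex_hilbert) \<Rightarrow> ('k \<Rightarrow> 'a::complex_hilbert) \<Rightarrow> 'a set"
  where "multiplier_dom K m \<phi> \<psi> = {f. (\<lambda>k. (m k * cinner f (\<psi> k)) *\<^sub>C \<phi> k) summable_on K}"

definition multiplier ::
  "'k set \<Rightarrow> ('k \<Rightarrow> complex) \<Rightarrow> ('k \<Rightarrow> 'b::complex_hilbert) \<Rightarrow> ('k \<Rightarrow> 'a::complex_hilbert) \<Rightarrow> 'a \<Rightarrow> 'b"
  where "multiplier K m \<phi> \<psi> f = (\<Sum>\<^sub>\<infinity>k\<in>K. (m k * cinner f (\<psi> k)) *\<^sub>C \<phi> k)"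

definition op_norm_on ::
  "'a::real_normed_vector set \<Rightarrow> ('a \<Rightarrow> 'b::real_normed_vector) \<Rightarrow> ennreal" where
  "op_norm_on D T = (SUP x\<in>{x\<in>D. norm x \<le> 1}. ennreal (norm (T x)))"

end

theory Submission
  imports Defs
begin

text \<open>Testing the upper Riesz inequality of \<open>\<psi>\<close> against \<open>f\<close> gives the Bessel inequality
  \<open>\<Sum>\<bar>\<langle>f, \<psi>\<^sub>k\<rangle>\<bar>\<^sup>2 \<le> B \<parallel>f\<parallel>\<^sup>2\<close>; together with the upper Riesz inequality of \<open>\<phi>\<close> it bounds the
  multiplier from above. For the lower bound, the lower Riesz inequality says that \<open>\<psi>\<^sub>k\<close> has
  distance at least \<open>\<surd>A\<close> from the span of the other \<open>\<psi>\<^sub>j\<close>. The component \<open>g\<close> of \<open>\<psi>\<^sub>k\<close>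
  orthogonal to that span, divided by its norm, is therefore a unit vector \<open>f\<close> with
  \<open>\<langle>f, \<psi>\<^sub>j\<rangle> = 0\<close> for \<open>j \<noteq> k\<close> and \<open>\<langle>f, \<psi>\<^sub>k\<rangle> = \<parallel>g\<parallel> \<ge> \<surd>A\<close>. The multiplier maps \<open>f\<close> to
  \<open>m\<^sub>k \<parallel>g\<parallel> \<phi>\<^sub>k\<close>, whose norm is at least \<open>\<surd>(AA') \<bar>m\<^sub>k\<bar>\<close>; this also works for unbounded \<open>m\<close>.\<close>

section \<open>Inner product algebra and the Cauchy-Schwarz inequality\<close>

lemma cinner_add_right: "cinner x (y + z) = cinner x y + cinner x z"
  for x :: "'a::complex_hilbert"
  by (metis cinner_add_left cinner_commute complex_cnj_add)

lemma cinner_scaleC_right: "cinner x (a *\<^sub>C y) = cnj a * cinner x y"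
  for x :: "'a::complex_hilbert"
  by (metis cinner_scaleC_left cinner_commute complex_cnj_mult)

lemma cinner_zero_right [simp]: "cinner x 0 = 0" for x :: "'a::complex_hilbert"
  using cinner_add_right[of x 0 0] by simp

lemma cinner_minus_right: "cinner x (- y) = - cinner x y" for x :: "'a::complex_hilbert"
  using cinner_add_right[of x y "- y"] by (simp add: eq_neg_iff_add_eq_0 add.commute)

lemma cinner_diff_right: "cinner x (y - z) = cinner x y - cinner x z"
  for x :: "'a::complex_hilbert"
  using cinner_add_right[of x y "- z"] by (simp add: cinner_minus_right)

lemma cinner_sum_right: "cinner x (\<Sum>i\<in>F. f i) = (\<Sum>i\<in>F. cinner x (f i))"
  for x :: "'a::complex_hilbert"
  by (induction F rule: infinite_finite_induct) (simp_all add: cinner_add_right)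

text \<open>The norm axioms give homogeneity for real scalars only; for complex ones it is recovered
  from \<open>cinner_self\<close> by comparing squares.\<close>

lemma norm_scaleC: "norm (a *\<^sub>C x) = cmod a * norm x" for x :: "'a::complex_hilbert"
proof -
  have "complex_of_real ((norm (a *\<^sub>C x))\<^sup>2) = (a * cnj a) * complex_of_real ((norm x)\<^sup>2)"
    by (simp only: cinner_self[symmetric] cinner_scaleC_left cinner_scaleC_right mult_ac)
  also have "\<dots> = complex_of_real ((cmod a * norm x)\<^sup>2)"
    by (simp only: complex_mult_cnj cmod_power2 power_mult_distrib of_real_mult)
  finally have "(norm (a *\<^sub>C x))\<^sup>2 = (cmod a * norm x)\<^sup>2"
    by (simp only: of_real_eq_iff)
  then show ?thesis by (simp add: power2_eq_iff_nonneg)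
qed

lemma norm_add_square:
  "(norm (x + y))\<^sup>2 = (norm x)\<^sup>2 + (norm y)\<^sup>2 + 2 * Re (cinner x y)"
  for x :: "'a::complex_hilbert"
proof -
  have "complex_of_real ((norm (x + y))\<^sup>2)
    = cinner x x + cinner y y + (cinner x y + cnj (cinner x y))"
    by (simp only: cinner_self[symmetric] cinner_add_left cinner_add_right
        cinner_commute[of y x] add_ac)
  also have "\<dots> = complex_of_real ((norm x)\<^sup>2 + (norm y)\<^sup>2 + 2 * Re (cinner x y))"
    by (simp only: cinner_self complex_add_cnj of_real_add)
  finally show ?thesis by (simp only: of_real_eq_iff)
qed

lemma parallelogram:
  "(norm (x + y))\<^sup>2 + (norm (x - y))\<^sup>2 = 2 * (norm x)\<^sup>2 + 2 * (norm y)\<^sup>2"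
  for x :: "'a::complex_hilbert"
  using norm_add_square[of x y] norm_add_square[of x "- y"]
  by (simp add: cinner_minus_right)

text \<open>Here \<open>t *\<^sub>C y\<close> is the orthogonal projection of \<open>x\<close> onto
  the line through \<open>y\<close>, so this is Pythagoras for the residual. Nonnegativity of the
  left side yields Cauchy-Schwarz, and the same choice of \<open>t\<close> later shows that a vector
  of minimal norm is orthogonal to a subspace.\<close>

lemma norm_residual_square:
  fixes x y :: "'a::complex_hilbert"
  defines "t \<equiv> cinner x y / complex_of_real ((norm y)\<^sup>2)"
  assumes "y \<noteq> 0"
  shows "(norm (x - t *\<^sub>C y))\<^sup>2 = (norm x)\<^sup>2 - (cmod (cinner x y))\<^sup>2 / (norm y)\<^sup>2"
proof -
  let ?n = "(norm y)\<^sup>2"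
  have n: "?n > 0" using assms by simp
  have "cnj t * cinner x y = complex_of_real ((cmod (cinner x y))\<^sup>2 / ?n)"
    using complex_norm_square[of "cinner x y"] by (simp add: t_def mult.commute)
  then have re: "Re (cnj t * cinner x y) = (cmod (cinner x y))\<^sup>2 / ?n"
    by (metis Re_complex_of_real)
  have ct: "cmod t = cmod (cinner x y) / ?n"
    by (simp add: t_def norm_divide norm_power)
  have "(norm (t *\<^sub>C y))\<^sup>2 = (cmod (cinner x y))\<^sup>2 / ?n"
    using n unfolding norm_scaleC by (simp add: ct power_mult_distrib power_divide)
      (simp add: power2_eq_square power4_eq_xxxx)
  then show ?thesis
    using norm_add_square[of x "- (t *\<^sub>C y)"] re
    by (simp add: cinner_minus_right cinner_scaleC_right)
qed

lemma cinner_Cauchy_Schwarz: "cmod (cinner x y) \<le> norm x * norm y"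
  for x :: "'a::complex_hilbert"
proof (cases "y = 0")
  case False
  have "0 \<le> (norm x)\<^sup>2 - (cmod (cinner x y))\<^sup>2 / (norm y)\<^sup>2"
    unfolding norm_residual_square[OF False, symmetric] by simp
  then have "(cmod (cinner x y))\<^sup>2 \<le> (norm x * norm y)\<^sup>2"
    using False by (simp add: field_simps power_mult_distrib)
  then show ?thesis by (rule power2_le_imp_le) simp
qed simp

section \<open>Projection by a minimising sequence\<close>

text \<open>The vector \<open>g\<close> is the limit of a norm-minimising sequence in the coset of
  \<open>x\<close> modulo \<open>S\<close>. As \<open>S\<close> may fail to be closed,
  \<open>x - g\<close> need only lie in its closure; the sequence \<open>u\<close> is therefore
  passed on along with its limit.\<close>

lemma orthogonal_component:
  fixes x :: "'a::complex_hilbert"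
  assumes S: "complex_vector.subspace S"
  obtains g u where "\<And>s. s \<in> S \<Longrightarrow> cinner g s = 0"
    and "\<And>n. x - u n \<in> S" and "u \<longlonglongrightarrow> g"
proof -
  define C where "C = {v. x - v \<in> S}"
  define d where "d = (INF v\<in>C. (norm v)\<^sup>2)"
  have "x \<in> C" using S by (simp add: C_def complex_vector.subspace_0)
  have bdd: "bdd_below ((\<lambda>v. (norm v)\<^sup>2) ` C)" by (rule bdd_belowI2[of _ 0]) simp
  have d_le: "d \<le> (norm v)\<^sup>2" if "v \<in> C" for v
    unfolding d_def by (rule cINF_lower[OF bdd that])
  have "\<exists>v\<in>C. (norm v)\<^sup>2 < d + 1 / real (Suc n)" for n
    using cINF_less_iff[OF _ bdd, of "d + 1 / real (Suc n)"] \<open>x \<in> C\<close>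
    by (auto simp: d_def)
  then obtain u where u: "\<And>n. u n \<in> C" "\<And>n. (norm (u n))\<^sup>2 < d + 1 / real (Suc n)"
    by metis
  \<comment> \<open>The midpoint of two elements of \<open>C\<close> is again in \<open>C\<close>,
    so \<open>\<parallel>u i + u j\<parallel>\<close> squared is at least \<open>4 * d\<close>. In
    the parallelogram law this cancels the \<open>4 * d\<close> coming from the bounds on
    \<open>u i\<close> and \<open>u j\<close>.\<close>
  have close: "(norm (u i - u j))\<^sup>2 \<le> 2 / real (Suc i) + 2 / real (Suc j)" for i j
  proof -
    have "x - (1/2) *\<^sub>R (u i + u j)
        = complex_of_real (1/2) *\<^sub>C (x - u i) + complex_of_real (1/2) *\<^sub>C (x - u j)"
      unfolding scaleR_scaleC[symmetric]
      by (simp add: scaleR_right_diff_distrib scaleR_add_right)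
        (simp flip: scaleR_left_distrib add: algebra_simps)
    also have "\<dots> \<in> S"
      using S u(1) by (auto simp: C_def intro!: complex_vector.subspace_add
          complex_vector.subspace_scale)
    finally have "(1/2) *\<^sub>R (u i + u j) \<in> C" by (simp add: C_def)
    from d_le[OF this] have "4 * d \<le> (norm (u i + u j))\<^sup>2"
      by (simp add: power_mult_distrib power_divide)
    then show ?thesis
      using parallelogram[of "u i" "u j"] u(2)[of i] u(2)[of j] by argo
  qed
  have "Cauchy u"
  proof (rule CauchyI)
    fix e :: real assume "e > 0"
    \<comment> \<open>Each of the two summands in \<open>close\<close> must stay below half of
      \<open>e\<close> squared, hence the quarter.\<close>
    then obtain N where N: "1 / real (Suc N) < e\<^sup>2 / 4"
      using nat_approx_posE[of "e\<^sup>2 / 4"] by (metis divide_pos_pos zero_less_power zero_less_numeral)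
    have "norm (u i - u j) < e" if "i \<ge> N" "j \<ge> N" for i j
    proof (rule power2_less_imp_less)
      have "1 / real (Suc i) \<le> 1 / real (Suc N)" "1 / real (Suc j) \<le> 1 / real (Suc N)"
        using that by (auto intro!: divide_left_mono)
      then show "(norm (u i - u j))\<^sup>2 < e\<^sup>2" using close[of i j] N by argo
    qed (use \<open>e > 0\<close> in simp)
    then show "\<exists>N. \<forall>i\<ge>N. \<forall>j\<ge>N. norm (u i - u j) < e" by blast
  qed
  then obtain g where g: "u \<longlonglongrightarrow> g"
    using convergent_eq_Cauchy by blast
  have "(norm g)\<^sup>2 \<le> d"
  proof (rule LIMSEQ_le)
    show "(\<lambda>n. (norm (u n))\<^sup>2) \<longlonglongrightarrow> (norm g)\<^sup>2" by (intro tendsto_intros g)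
    show "(\<lambda>n. d + 1 / real (Suc n)) \<longlonglongrightarrow> d"
      using tendsto_add[OF tendsto_const LIMSEQ_Suc[OF lim_1_over_n]] by simp
  qed (use u(2) less_imp_le in blast)
  moreover have "cinner g s = 0" if "s \<in> S" "(norm g)\<^sup>2 \<le> d" for s
  proof (cases "s = 0")
    case False
    define t where "t = cinner g s / complex_of_real ((norm s)\<^sup>2)"
    \<comment> \<open>The limit \<open>g\<close> itself may lie outside \<open>C\<close>, so
      minimality is applied to the perturbed \<open>u n\<close> and then passed to the limit. With
      this \<open>t\<close> the perturbation of \<open>g\<close> would have squared norm below
      \<open>d\<close> unless \<open>cinner g s\<close> vanishes.\<close>
    have "u n - t *\<^sub>C s \<in> C" for n
      using complex_vector.subspace_add[OF S, of "x - u n" "t *\<^sub>C s"] u(1)[of n] that S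
      by (simp add: C_def complex_vector.subspace_scale algebra_simps)
    then have "d \<le> (norm (u n - t *\<^sub>C s))\<^sup>2" for n by (rule d_le)
    moreover have "(\<lambda>n. (norm (u n - t *\<^sub>C s))\<^sup>2) \<longlonglongrightarrow> (norm (g - t *\<^sub>C s))\<^sup>2"
      by (intro tendsto_intros g)
    ultimately have "d \<le> (norm (g - t *\<^sub>C s))\<^sup>2"
      by (intro LIMSEQ_le_const) auto
    then have "(cmod (cinner g s))\<^sup>2 / (norm s)\<^sup>2 \<le> 0"
      using norm_residual_square[OF False, of g] that(2) by (simp add: t_def)
    then show ?thesis using False by (simp add: divide_le_0_iff)
  qed simp
  ultimately show thesis using that u(1) g by (auto simp: C_def)
qed

section \<open>Finite Riesz inequalities and the Bessel inequality\<close>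

text \<open>Extending the coefficients by zero outside \<open>F\<close> gives an element of
  \<open>l2 K\<close> for which all infinite sums collapse to sums over \<open>F\<close>.\<close>

lemma riesz_basis_finite:
  fixes \<psi> :: "'k \<Rightarrow> 'a::complex_hilbert"
  assumes "riesz_basis K \<psi> A B" "finite F" "F \<subseteq> K"
  shows "A * (\<Sum>k\<in>F. (cmod (c k))\<^sup>2) \<le> (norm (\<Sum>k\<in>F. c k *\<^sub>C \<psi> k))\<^sup>2"
    and "(norm (\<Sum>k\<in>F. c k *\<^sub>C \<psi> k))\<^sup>2 \<le> B * (\<Sum>k\<in>F. (cmod (c k))\<^sup>2)"
proof -
  define c' where "c' k = (if k \<in> F then c k else 0)" for k
  have "(\<lambda>k. (cmod (c' k))\<^sup>2) summable_on K
      \<longleftrightarrow> (\<lambda>k. (cmod (c k))\<^sup>2) summable_on F"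
    by (rule summable_on_cong_neutral) (use assms(3) in \<open>auto simp: c'_def\<close>)
  then have l2: "c' \<in> l2 K" using assms(2) by (simp add: l2_def)
  have "(\<Sum>\<^sub>\<infinity>k\<in>K. (cmod (c' k))\<^sup>2) = (\<Sum>\<^sub>\<infinity>k\<in>F. (cmod (c k))\<^sup>2)"
    by (rule infsum_cong_neutral) (use assms(3) in \<open>auto simp: c'_def\<close>)
  then have norm: "(l2_norm K c')\<^sup>2 = (\<Sum>k\<in>F. (cmod (c k))\<^sup>2)"
    using assms(2) by (simp add: l2_norm_def sum_nonneg)
  have "(\<Sum>\<^sub>\<infinity>k\<in>K. c' k *\<^sub>C \<psi> k) = (\<Sum>\<^sub>\<infinity>k\<in>F. c k *\<^sub>C \<psi> k)"
    by (rule infsum_cong_neutral) (use assms(3) in \<open>auto simp: c'_def\<close>)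
  then have sum: "(\<Sum>\<^sub>\<infinity>k\<in>K. c' k *\<^sub>C \<psi> k) = (\<Sum>k\<in>F. c k *\<^sub>C \<psi> k)"
    using assms(2) by simp
  show "A * (\<Sum>k\<in>F. (cmod (c k))\<^sup>2) \<le> (norm (\<Sum>k\<in>F. c k *\<^sub>C \<psi> k))\<^sup>2"
    and "(norm (\<Sum>k\<in>F. c k *\<^sub>C \<psi> k))\<^sup>2 \<le> B * (\<Sum>k\<in>F. (cmod (c k))\<^sup>2)"
    using assms(1) l2 norm sum unfolding riesz_basis_def by metis+
qed

text \<open>Working on finite sets avoids presupposing that the coefficients of \<open>f\<close> are
  square summable. Pairing \<open>f\<close> with \<open>v\<close> gives exactly \<open>s\<close>, so
  Cauchy-Schwarz and the upper Riesz inequality bound the square of \<open>s\<close> by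
  \<open>B * s\<close> times the squared norm of \<open>f\<close>.\<close>

lemma riesz_basis_Bessel_finite:
  fixes \<psi> :: "'k \<Rightarrow> 'a::complex_hilbert"
  assumes "riesz_basis K \<psi> A B" "finite F" "F \<subseteq> K"
  shows "(\<Sum>k\<in>F. (cmod (cinner f (\<psi> k)))\<^sup>2) \<le> B * (norm f)\<^sup>2"
proof -
  define c where "c k = cinner f (\<psi> k)" for k
  define s where "s = (\<Sum>k\<in>F. (cmod (c k))\<^sup>2)"
  define v where "v = (\<Sum>k\<in>F. c k *\<^sub>C \<psi> k)"
  have "s \<ge> 0" by (simp add: s_def sum_nonneg)
  have "cinner f v = complex_of_real s"
    by (simp add: v_def s_def cinner_sum_right cinner_scaleC_right c_def complex_norm_square
        mult.commute del: of_real_power)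
  then have "s \<le> norm f * norm v"
    using cinner_Cauchy_Schwarz[of f v] \<open>s \<ge> 0\<close> by simp
  then have "s\<^sup>2 \<le> (norm f)\<^sup>2 * (norm v)\<^sup>2"
    using \<open>s \<ge> 0\<close> by (metis power_mono power_mult_distrib)
  also have "\<dots> \<le> (norm f)\<^sup>2 * (B * s)"
    using riesz_basis_finite(2)[OF assms, of c]
    by (intro mult_left_mono) (auto simp: v_def s_def)
  finally have "s * s \<le> (B * (norm f)\<^sup>2) * s" by (simp add: power2_eq_square mult_ac)
  moreover have "0 \<le> B * (norm f)\<^sup>2" using assms(1) by (simp add: riesz_basis_def)
  ultimately have "s \<le> B * (norm f)\<^sup>2"
    using \<open>s \<ge> 0\<close> by (cases "s = 0") auto
  then show ?thesis by (simp add: s_def c_def)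
qed

lemma riesz_basis_Bessel:
  fixes \<psi> :: "'k \<Rightarrow> 'a::complex_hilbert"
  assumes "riesz_basis K \<psi> A B"
  shows "(\<lambda>k. (cmod (cinner f (\<psi> k)))\<^sup>2) summable_on K"
    and "(\<Sum>\<^sub>\<infinity>k\<in>K. (cmod (cinner f (\<psi> k)))\<^sup>2) \<le> B * (norm f)\<^sup>2"
proof -
  show *: "(\<lambda>k. (cmod (cinner f (\<psi> k)))\<^sup>2) summable_on K"
    \<comment> \<open>The bound on finite partial sums is uniform, which suffices for nonnegative
      terms.\<close>
    by (rule nonneg_bounded_partial_sums_imp_summable_on[where C = "B * (norm f)\<^sup>2"])
      (auto simp: eventually_finite_subsets_at_top_weakI riesz_basis_Bessel_finite[OF assms])
  show "(\<Sum>\<^sub>\<infinity>k\<in>K. (cmod (cinner f (\<psi> k)))\<^sup>2) \<le> B * (norm f)\<^sup>2"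
    by (rule infsum_le_finite_sums[OF * riesz_basis_Bessel_finite[OF assms]])
qed

section \<open>Separation from the other basis vectors and biorthogonality\<close>

text \<open>Coefficients are indexed by \<open>J\<close> rather than by the vectors of the image,
  the form to which the Riesz inequalities apply; injectivity of \<open>\<psi>\<close> is not
  presupposed.\<close>

lemma cspan_image_finite_sum:
  fixes \<psi> :: "'k \<Rightarrow> 'a::complex_vector"
  assumes "s \<in> cspan (\<psi> ` J)"
  obtains F c where "finite F" "F \<subseteq> J" "s = (\<Sum>j\<in>F. c j *\<^sub>C \<psi> j)"
proof -
  have "\<exists>F c. finite F \<and> F \<subseteq> J \<and> s = (\<Sum>j\<in>F. c j *\<^sub>C \<psi> j)"
    using assms
  proof (induction rule: complex_vector.span_induct_alt)
    case base
    show ?case by (rule exI[of _ "{}"]) simp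
  next
    case (step a x y)
    then obtain i F c where i: "i \<in> J" "x = \<psi> i" and F: "finite F" "F \<subseteq> J"
      and y: "y = (\<Sum>j\<in>F. c j *\<^sub>C \<psi> j)" by auto
    \<comment> \<open>The index \<open>i\<close> may already occur in \<open>F\<close>, so the new
      coefficient is added to the old one.\<close>
    define c' where "c' j = (if j \<in> F then c j else 0) + (if j = i then a else 0)" for j
    have "(\<Sum>j\<in>insert i F. c' j *\<^sub>C \<psi> j)
        = (\<Sum>j\<in>insert i F. (if j \<in> F then c j *\<^sub>C \<psi> j else 0))
          + (\<Sum>j\<in>insert i F. (if j = i then a *\<^sub>C \<psi> j else 0))"
      by (simp only: sum.distrib[symmetric])
        (rule sum.cong, auto simp: c'_def scaleC_add_left)
    also have "(\<Sum>j\<in>insert i F. (if j \<in> F then c j *\<^sub>C \<psi> j else 0)) = y"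
      unfolding y by (rule sum.mono_neutral_cong_right) (use F in auto)
    also have "(\<Sum>j\<in>insert i F. (if j = i then a *\<^sub>C \<psi> j else 0)) = a *\<^sub>C x"
      using F i by (simp add: sum.delta)
    finally have "a *\<^sub>C x + y = (\<Sum>j\<in>insert i F. c' j *\<^sub>C \<psi> j)" by (simp add: add.commute)
    then show ?case using F i by (metis finite_insert insert_subset)
  qed
  then show thesis using that by blast
qed

text \<open>In \<open>\<psi> k - s\<close> the vector \<open>\<psi> k\<close> has coefficient 1, so
  the squared coefficients sum to at least 1 and the lower Riesz inequality applies.\<close>

lemma riesz_basis_dist_span:
  fixes \<psi> :: "'k \<Rightarrow> 'a::complex_hilbert"
  assumes R: "riesz_basis K \<psi> A B" and "k \<in> K" and s: "s \<in> cspan (\<psi> ` (K - {k}))"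
  shows "sqrt A \<le> norm (\<psi> k - s)"
proof -
  obtain F c where F: "finite F" "F \<subseteq> K - {k}" and s: "s = (\<Sum>j\<in>F. c j *\<^sub>C \<psi> j)"
    using cspan_image_finite_sum[OF s] .
  define c' where "c' j = (if j = k then 1 else - c j)" for j
  have "k \<notin> F" using F by auto
  have c': "c' j = - c j" if "j \<in> F" for j using that \<open>k \<notin> F\<close> by (auto simp: c'_def)
  have "(\<Sum>j\<in>insert k F. c' j *\<^sub>C \<psi> j) = \<psi> k - s"
    using F \<open>k \<notin> F\<close>
    by (simp add: c' s sum_negf scaleC_one) (simp add: c'_def scaleC_one)
  then have "A * (\<Sum>j\<in>insert k F. (cmod (c' j))\<^sup>2) \<le> (norm (\<psi> k - s))\<^sup>2"
    using riesz_basis_finite(1)[OF R, of "insert k F" c'] F \<open>k \<in> K\<close> by auto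
  moreover have "1 \<le> (\<Sum>j\<in>insert k F. (cmod (c' j))\<^sup>2)"
    using F \<open>k \<notin> F\<close> by (simp add: c'_def sum_nonneg)
  moreover have "A > 0" using R by (simp add: riesz_basis_def)
  ultimately have "A \<le> (norm (\<psi> k - s))\<^sup>2"
    by (smt (verit) mult_le_cancel_left1)
  then show ?thesis by (simp add: real_le_lsqrt)
qed

lemma riesz_basis_biorthogonal:
  fixes \<psi> :: "'k \<Rightarrow> 'a::complex_hilbert"
  assumes R: "riesz_basis K \<psi> A B" and "k \<in> K"
  obtains f where "norm f = 1" "\<And>j. j \<in> K - {k} \<Longrightarrow> cinner f (\<psi> j) = 0"
    "sqrt A \<le> cmod (cinner f (\<psi> k))"
proof -
  let ?S = "cspan (\<psi> ` (K - {k}))"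
  obtain g u where orth: "\<And>s. s \<in> ?S \<Longrightarrow> cinner g s = 0"
    and u: "\<And>n. \<psi> k - u n \<in> ?S" and lim: "u \<longlonglongrightarrow> g"
    using orthogonal_component[OF complex_vector.subspace_span] by blast
  have "sqrt A \<le> norm (u n)" for n
    using riesz_basis_dist_span[OF R \<open>k \<in> K\<close> u[of n]] by simp
  then have ge: "sqrt A \<le> norm g"
    by (intro LIMSEQ_le_const[OF tendsto_norm[OF lim]]) auto
  moreover have "A > 0" using R by (simp add: riesz_basis_def)
  ultimately have pos: "norm g > 0" by (smt (verit) real_sqrt_gt_zero)
  \<comment> \<open>Orthogonality is available for \<open>\<psi> k - u n\<close> only. The error
    made by replacing \<open>u n\<close> with \<open>g\<close> tends to zero by Cauchy-Schwarz,
    which identifies \<open>cinner g (\<psi> k)\<close> with \<open>cinner g g\<close>.\<close>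
  have "cinner g (\<psi> k) - cinner g g = cinner g (u n - g)" for n
    using orth[OF u[of n]] by (simp add: cinner_diff_right)
  then have "cmod (cinner g (\<psi> k) - cinner g g) \<le> norm g * norm (u n - g)" for n
    by (metis cinner_Cauchy_Schwarz)
  moreover have "(\<lambda>n. norm g * norm (u n - g)) \<longlonglongrightarrow> norm g * norm (g - g)"
    by (intro tendsto_intros lim)
  ultimately have "cmod (cinner g (\<psi> k) - cinner g g) \<le> norm g * norm (g - g)"
    by (intro LIMSEQ_le_const) auto
  then have gk: "cinner g (\<psi> k) = complex_of_real ((norm g)\<^sup>2)" by (simp add: cinner_self)
  show thesis
  proof (rule that[of "complex_of_real (1 / norm g) *\<^sub>C g"])
    show "norm (complex_of_real (1 / norm g) *\<^sub>C g) = 1"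
      using pos by (simp add: norm_scaleC norm_divide)
    show "cinner (complex_of_real (1 / norm g) *\<^sub>C g) (\<psi> j) = 0" if "j \<in> K - {k}" for j
      using orth[of "\<psi> j"] that by (simp add: cinner_scaleC_left complex_vector.span_base)
    show "sqrt A \<le> cmod (cinner (complex_of_real (1 / norm g) *\<^sub>C g) (\<psi> k))"
      using pos ge by (simp add: cinner_scaleC_left gk norm_mult norm_divide norm_power
          power2_eq_square)
  qed
qed

section \<open>Lower bound on the domain of convergence\<close>

lemma op_norm_multiplier_ge:
  fixes \<psi> :: "'k \<Rightarrow> 'a::complex_hilbert" and \<phi> :: "'k \<Rightarrow> 'b::complex_hilbert"
  assumes R: "riesz_basis K \<psi> A B" and R': "riesz_basis K \<phi> A' B'"
  shows "ennreal (sqrt (A * A')) * linf_norm K m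
    \<le> op_norm_on (multiplier_dom K m \<phi> \<psi>) (multiplier K m \<phi> \<psi>)"
proof -
  have "ennreal (sqrt (A * A')) * ennreal (cmod (m k))
      \<le> op_norm_on (multiplier_dom K m \<phi> \<psi>) (multiplier K m \<phi> \<psi>)" if k: "k \<in> K" for k
  proof -
    obtain f where f: "norm f = 1" "\<And>j. j \<in> K - {k} \<Longrightarrow> cinner f (\<psi> j) = 0"
      "sqrt A \<le> cmod (cinner f (\<psi> k))"
      using riesz_basis_biorthogonal[OF R k] by metis
    let ?t = "\<lambda>j. (m j * cinner f (\<psi> j)) *\<^sub>C \<phi> j"
    \<comment> \<open>All terms except the one at \<open>k\<close> vanish, so the series converges
      at \<open>f\<close> however fast \<open>m\<close> grows.\<close>
    have "?t summable_on K \<longleftrightarrow> ?t summable_on {k}"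
      by (rule summable_on_cong_neutral) (use f k in auto)
    then have dom: "f \<in> multiplier_dom K m \<phi> \<psi>" by (simp add: multiplier_dom_def)
    have "infsum ?t K = infsum ?t {k}"
      by (rule infsum_cong_neutral) (use f k in auto)
    then have M: "multiplier K m \<phi> \<psi> f = ?t k" by (simp add: multiplier_def)
    \<comment> \<open>This is the lower Riesz inequality for the single coefficient 1 at
      \<open>k\<close>.\<close>
    have "sqrt A' \<le> norm (\<phi> k)"
      using riesz_basis_finite(1)[OF R', of "{k}" "\<lambda>_. 1"] k by (simp add: scaleC_one real_le_lsqrt)
    then have "sqrt (A * A') * cmod (m k)
        \<le> (cmod (cinner f (\<psi> k)) * norm (\<phi> k)) * cmod (m k)"
      using f(3) R R' unfolding real_sqrt_mult
      by (intro mult_right_mono mult_mono) (auto simp: riesz_basis_def)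
    also have "\<dots> = norm (multiplier K m \<phi> \<psi> f)"
      by (simp add: M norm_scaleC norm_mult)
    finally have "ennreal (sqrt (A * A')) * ennreal (cmod (m k))
        \<le> ennreal (norm (multiplier K m \<phi> \<psi> f))"
      using R R' by (simp add: riesz_basis_def flip: ennreal_mult)
    also have "\<dots> \<le> op_norm_on (multiplier_dom K m \<phi> \<psi>) (multiplier K m \<phi> \<psi>)"
      unfolding op_norm_on_def by (rule SUP_upper) (use dom f(1) in simp)
    finally show ?thesis .
  qed
  then show ?thesis
    unfolding linf_norm_def SUP_mult_left_ennreal by (intro SUP_least)
qed

section \<open>Upper bound for bounded symbols\<close>

lemma linf_norm_finite_iff: "linf_norm K m < \<infinity> \<longleftrightarrow> m \<in> linf K"
proof
  assume fin: "linf_norm K m < \<infinity>"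
  have "cmod (m k) \<le> enn2real (linf_norm K m)" if "k \<in> K" for k
    using enn2real_mono[of "ennreal (cmod (m k))" "linf_norm K m"] fin
      SUP_upper[OF that, of "\<lambda>k. ennreal (cmod (m k))"]
    by (simp add: linf_norm_def)
  then show "m \<in> linf K" unfolding linf_def bounded_iff by auto
next
  assume "m \<in> linf K"
  then obtain M where M: "\<And>k. k \<in> K \<Longrightarrow> cmod (m k) \<le> M"
    unfolding linf_def bounded_iff by auto
  have "linf_norm K m \<le> ennreal M"
    unfolding linf_norm_def by (intro SUP_least ennreal_leI M)
  then show "linf_norm K m < \<infinity>" by (simp add: le_less_trans)
qed

text \<open>Multiplying the Bessel coefficients of \<open>f\<close> by bounded factors keeps them in
  \<open>l2 K\<close>, so the Riesz condition on \<open>\<phi>\<close> gives both convergence and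
  the norm estimate.\<close>

lemma multiplier_bounded:
  fixes \<psi> :: "'k \<Rightarrow> 'a::complex_hilbert" and \<phi> :: "'k \<Rightarrow> 'b::complex_hilbert"
  assumes R: "riesz_basis K \<psi> A B" and R': "riesz_basis K \<phi> A' B'"
    and M: "0 \<le> M" "\<And>k. k \<in> K \<Longrightarrow> cmod (m k) \<le> M"
  shows "f \<in> multiplier_dom K m \<phi> \<psi>"
    and "norm (multiplier K m \<phi> \<psi> f) \<le> sqrt (B * B') * M * norm f"
proof -
  let ?a = "\<lambda>k. cinner f (\<psi> k)"
  let ?c = "\<lambda>k. m k * ?a k"
  have le: "(cmod (?c k))\<^sup>2 \<le> M\<^sup>2 * (cmod (?a k))\<^sup>2" if "k \<in> K" for k
    using M that by (auto simp: norm_mult power_mult_distrib intro!: mult_right_mono power_mono)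
  have sum: "(\<lambda>k. M\<^sup>2 * (cmod (?a k))\<^sup>2) summable_on K"
    by (rule summable_on_cmult_right[OF riesz_basis_Bessel(1)[OF R]])
  have sumc: "(\<lambda>k. (cmod (?c k))\<^sup>2) summable_on K"
    by (rule summable_on_comparison_test[OF sum le]) auto
  then have l2: "?c \<in> l2 K" by (simp add: l2_def)
  then show "f \<in> multiplier_dom K m \<phi> \<psi>"
    using R' by (simp add: multiplier_dom_def riesz_basis_def)
  have "B > 0" "B' > 0" using R R' by (auto simp: riesz_basis_def)
  have "(norm (multiplier K m \<phi> \<psi> f))\<^sup>2 \<le> B' * (l2_norm K ?c)\<^sup>2"
    using R' l2 by (simp add: multiplier_def riesz_basis_def)
  also have "(l2_norm K ?c)\<^sup>2 = (\<Sum>\<^sub>\<infinity>k\<in>K. (cmod (?c k))\<^sup>2)"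
    by (simp add: l2_norm_def infsum_nonneg)
  also have "\<dots> \<le> (\<Sum>\<^sub>\<infinity>k\<in>K. M\<^sup>2 * (cmod (?a k))\<^sup>2)"
    by (rule infsum_mono[OF sumc sum le])
  also have "\<dots> = M\<^sup>2 * (\<Sum>\<^sub>\<infinity>k\<in>K. (cmod (?a k))\<^sup>2)"
    by (rule infsum_cmult_right')
  also have "\<dots> \<le> M\<^sup>2 * (B * (norm f)\<^sup>2)"
    by (intro mult_left_mono riesz_basis_Bessel(2)[OF R]) simp
  finally have "(norm (multiplier K m \<phi> \<psi> f))\<^sup>2 \<le> (sqrt (B * B') * M * norm f)\<^sup>2"
    using \<open>B > 0\<close> \<open>B' > 0\<close> by (simp add: power_mult_distrib mult_ac)
  then show "norm (multiplier K m \<phi> \<psi> f) \<le> sqrt (B * B') * M * norm f"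
    by (rule power2_le_imp_le) (use M \<open>B > 0\<close> \<open>B' > 0\<close> in simp)
qed

lemma multiplier_linf:
  fixes \<psi> :: "'k \<Rightarrow> 'a::complex_hilbert" and \<phi> :: "'k \<Rightarrow> 'b::complex_hilbert"
  assumes R: "riesz_basis K \<psi> A B" and R': "riesz_basis K \<phi> A' B'" and "m \<in> linf K"
  shows "multiplier_dom K m \<phi> \<psi> = UNIV"
    and "op_norm_on UNIV (multiplier K m \<phi> \<psi>) \<le> ennreal (sqrt (B * B')) * linf_norm K m"
proof -
  \<comment> \<open>Taking \<open>M\<close> to be the supremum itself, finite by assumption, yields
    the stated constant.\<close>
  obtain M where M: "0 \<le> M" "linf_norm K m = ennreal M"
    using \<open>m \<in> linf K\<close> linf_norm_finite_iff[of K m] by (cases "linf_norm K m") auto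
  have mM: "cmod (m k) \<le> M" if "k \<in> K" for k
    using SUP_upper[OF that, of "\<lambda>k. ennreal (cmod (m k))"] M by (simp add: linf_norm_def)
  show "multiplier_dom K m \<phi> \<psi> = UNIV"
    by (intro UNIV_eq_I[symmetric] multiplier_bounded(1)[OF R R' M(1) mM])
  have pos: "0 \<le> sqrt (B * B')" using R R' by (simp add: riesz_basis_def)
  have "norm (multiplier K m \<phi> \<psi> f) \<le> sqrt (B * B') * M" if "norm f \<le> 1" for f
  proof -
    have "norm (multiplier K m \<phi> \<psi> f) \<le> sqrt (B * B') * M * norm f"
      by (rule multiplier_bounded(2)[OF R R' M(1) mM])
    also have "\<dots> \<le> sqrt (B * B') * M * 1"
      using that M(1) pos by (intro mult_left_mono) auto
    finally show ?thesis by simp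
  qed
  then show "op_norm_on UNIV (multiplier K m \<phi> \<psi>) \<le> ennreal (sqrt (B * B')) * linf_norm K m"
    using M(1) pos unfolding op_norm_on_def M(2) ennreal_mult[OF pos M(1), symmetric]
    by (auto intro!: SUP_least ennreal_leI)
qed

theorem proposition7p2:
  fixes K :: "'k set"
    and \<psi> :: "'k \<Rightarrow> 'a::complex_hilbert" and \<phi> :: "'k \<Rightarrow> 'b::complex_hilbert"
    and m :: "'k \<Rightarrow> complex" and A B A' B' :: real
  assumes "separable_space (euclidean :: 'a topology)"
    and "separable_space (euclidean :: 'b topology)"
    and "riesz_basis K \<psi> A B" and "riesz_basis K \<phi> A' B'"
  shows "(m \<in> linf K \<longrightarrow>
      multiplier_dom K m \<phi> \<psi> = UNIV \<and>
      ennreal (sqrt (A * A')) * linf_norm K m \<le> op_norm_on UNIV (multiplier K m \<phi> \<psi>) \<and>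
      op_norm_on UNIV (multiplier K m \<phi> \<psi>) \<le> ennreal (sqrt (B * B')) * linf_norm K m) \<and>
    (multiplier_dom K m \<phi> \<psi> = UNIV \<and> op_norm_on UNIV (multiplier K m \<phi> \<psi>) < \<infinity>
      \<longleftrightarrow> m \<in> linf K) \<and>
    (op_norm_on (multiplier_dom K m \<phi> \<psi>) (multiplier K m \<phi> \<psi>) < \<infinity> \<longleftrightarrow> m \<in> linf K)"
proof -
  note R = assms(3) and R' = assms(4)
  have fin: "op_norm_on UNIV (multiplier K m \<phi> \<psi>) < \<infinity>" if "m \<in> linf K"
  proof -
    have "ennreal (sqrt (B * B')) * linf_norm K m < \<infinity>"
      using that linf_norm_finite_iff[of K m] by (simp add: ennreal_mult_less_top)
    then show ?thesis using multiplier_linf(2)[OF R R' that] by (rule le_less_trans[rotated])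
  qed
  \<comment> \<open>This implication serves both equivalences: when the domain is
    \<open>UNIV\<close>, the two operator norms coincide.\<close>
  have bdd: "m \<in> linf K"
    if "op_norm_on (multiplier_dom K m \<phi> \<psi>) (multiplier K m \<phi> \<psi>) < \<infinity>"
  proof -
    have "ennreal (sqrt (A * A')) * linf_norm K m < \<infinity>"
      using op_norm_multiplier_ge[OF R R', of m] that by (rule le_less_trans)
    \<comment> \<open>In \<open>ennreal\<close> the product of zero and infinity is zero, so
      finiteness passes to the second factor only if the first is nonzero.\<close>
    moreover have "ennreal (sqrt (A * A')) \<noteq> 0"
      using R R' by (simp add: riesz_basis_def)
    ultimately have "linf_norm K m < \<infinity>"
      by (auto simp: ennreal_mult_less_top)
    then show ?thesis by (simp only: linf_norm_finite_iff)
  qed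
  show ?thesis
    using multiplier_linf[OF R R', of m] op_norm_multiplier_ge[OF R R', of m] fin bdd
    by metis
qed

end
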